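(* Let $\mathsf{A}$ be a space ideal. Then the class $Op^{L}(\mathsf{A})$ of all $\mathsf{A}$-factorable Lipschitz operators is a nonlinear ideal.
   Context: All Banach spaces are over a common scalar field $\mathbb{K}$ ($\mathbb{R}$ or $\mathbb{C}$). All metric spaces are pointed, with base point denoted $0$; a Banach space is pointed by its zero vector. For pointed metric spaces $X,Y$, $Lip(X,Y)$ is the set of all Lipschitz maps $T:X\to Y$ with $T(0)=0$, and $Lip(T)$ is the Lipschitz constant of $T$. $X^{\#}=Lip(X,\mathbb{K})$ with norm $Lip(\cdot)$. For Banach spaces $E,F$, $\mathfrak{L}(E,F)$ is the space of bounded linear operators. For $g\in X^{\#}$ and $e\in F$, $g\boxtimes e\in Lip(X,F)$ is the map $x\mapsto g(x)e$. A nonlinear ideal $\mathcal{A}^{L}$ assigns to every pointed metric space $X$ and Banach space $F$ a subset $\mathcal{A}^{L}(X,F)\subseteq Lip(X,F)$ such that: (i) $g\boxtimes e\in\mathcal{A}^{L}(X,F)$ for all $g\in X^{\#}$, $e\in F$; (ii) $S+T\in\mathcal{A}^{L}(X,F)$ for all $S,T\in\mathcal{A}^{L}(X,F)$; (iii) $BTA\in\mathcal{A}^{L}(X_{0},F_{0})$ for all $A\in Lip(X_{0},X)$, $T\in\mathcal{A}^{L}(X,F)$, $B\in\mathfrak{L}(F,F_{0})$. A space ideal $\mathsf{A}$ is a class of Banach spaces which contains all finite-dimensional Banach spaces, contains $E_1\times E_2$ whenever it contains $E_1$ and $E_2$, and contains every Banach space isomorphic to a complemented subspace of a member of $\mathsf{A}$.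 A Lipschitz operator $T\in Lip(X,F)$ is called $\mathsf{A}$-factorable if there is a factorization $T=BA$ with $A\in Lip(X,\mathbf{M})$, $B\in\mathfrak{L}(\mathbf{M},F)$ and $\mathbf{M}\in\mathsf{A}$. *)

theory Defs
  imports "HOL-Analysis.Analysis" "HOL-Algebra.Module" "HOL-Algebra.Algebraic_Closure_Type"
begin

(* frees X as a variable name *)
no_notation var ("X\<index>")

text \<open>
  HOL cannot quantify over all Banach spaces of all types inside a formula.  Spaces are therefore
  structures whose carrier is an arbitrary subset of a universe type, \<open>'m\<close> for pointed metric
  spaces and \<open>'u\<close> for Banach spaces; both are arbitrary type variables.

  The scalar field is a type \<open>'k\<close> of sort \<open>{real_normed_field, banach}\<close>.  Both \<open>real\<close> and
  \<open>complex\<close> are instances, and, the norm being multiplicative, by Gelfand-Mazur there are no others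
  up to isometric isomorphism.
\<close>

text \<open>The fields \<open>mult\<close> and \<open>one\<close> inherited from the record \<open>module\<close> have no meaning here.\<close>

record ('k, 'a) nspace = "('k, 'a) module" +
  vnorm :: "'a \<Rightarrow> real"

locale normed_space =
  Module.module "ring_of_type_algebra :: 'k ring" E
    for E :: "('k::{real_normed_field, banach}, 'a) nspace" (structure) +
  assumes vnorm_nonneg: "x \<in> carrier E \<Longrightarrow> 0 \<le> vnorm E x"
    and vnorm_eq_0_iff: "x \<in> carrier E \<Longrightarrow> vnorm E x = 0 \<longleftrightarrow> x = \<zero>"
    and vnorm_triangle: "x \<in> carrier E \<Longrightarrow> y \<in> carrier E \<Longrightarrow> vnorm E (x \<oplus> y) \<le> vnorm E x + vnorm E y"
    and vnorm_smult: "x \<in> carrier E \<Longrightarrow> vnorm E (c \<odot> x) = norm c * vnorm E x"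

text \<open>
  \<open>Metric_space\<close> demands symmetry and nonnegativity of the distance also outside the carrier,
  hence the case distinction.
\<close>

definition norm_dist :: "('k, 'a) nspace \<Rightarrow> 'a \<Rightarrow> 'a \<Rightarrow> real" where
  "norm_dist E x y =
     (if x \<in> carrier E \<and> y \<in> carrier E then vnorm E (x \<ominus>\<^bsub>E\<^esub> y) else 0)"

definition norm_metric :: "('k, 'a) nspace \<Rightarrow> 'a metric" where
  "norm_metric E = metric (carrier E, norm_dist E)"

lemma (in normed_space) Metric_space_norm_dist: "Metric_space (carrier E) (norm_dist E)"
proof
  fix x y
  show "0 \<le> norm_dist E x y"
    by (simp add: norm_dist_def vnorm_nonneg)
  show "norm_dist E x y = norm_dist E y x"
  proof (cases "x \<in> carrier E \<and> y \<in> carrier E")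
    case True
    have "x \<ominus> y = \<ominus> (y \<ominus> x)"
      using True by (simp add: M.minus_eq M.minus_add M.a_comm)
    also have "\<dots> = (- 1 :: 'k) \<odot> (y \<ominus> x)"
    proof -
      have "(- 1 :: 'k) \<odot> (y \<ominus> x) \<oplus> (y \<ominus> x) = (- 1 :: 'k) \<odot> (y \<ominus> x) \<oplus> (1 :: 'k) \<odot> (y \<ominus> x)"
        using True smult_one[of "y \<ominus> x"] by (simp add: ring_of_type_algebra_def)
      also have "\<dots> = (- 1 + 1 :: 'k) \<odot> (y \<ominus> x)"
        using True smult_l_distr[of "- 1" 1 "y \<ominus> x"] by (simp add: ring_of_type_algebra_def)
      also have "\<dots> = \<zero>"
        using True smult_l_null[of "y \<ominus> x"] by (simp add: ring_of_type_algebra_def)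
      finally show ?thesis
        using True smult_closed[of "- 1" "y \<ominus> x"] M.minus_equality
        by (simp add: ring_of_type_algebra_def)
    qed
    finally have "vnorm E (x \<ominus> y) = vnorm E (y \<ominus> x)"
      using True vnorm_smult[of "y \<ominus> x" "- 1"] by simp
    then show ?thesis
      using True by (simp add: norm_dist_def)
  qed (auto simp: norm_dist_def)
next
  fix x y
  assume "x \<in> carrier E" "y \<in> carrier E"
  then show "norm_dist E x y = 0 \<longleftrightarrow> x = y"
    using M.minus_equality[of x "\<ominus> y"] M.r_neg[of y]
    by (auto simp: norm_dist_def vnorm_eq_0_iff M.minus_eq)
next
  fix x y z
  assume *: "x \<in> carrier E" "y \<in> carrier E" "z \<in> carrier E"
  then have "x \<ominus> z = (x \<ominus> y) \<oplus> (y \<ominus> z)"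
    by (simp add: M.minus_eq M.a_assoc M.r_neg1)
  then show "norm_dist E x z \<le> norm_dist E x y + norm_dist E y z"
    using * vnorm_triangle[of "x \<ominus> y" "y \<ominus> z"] by (simp add: norm_dist_def)
qed

lemma (in normed_space) mspace_norm_metric [simp]: "mspace (norm_metric E) = carrier E"
  and mdist_norm_metric [simp]: "mdist (norm_metric E) = norm_dist E"
  using Metric_space_norm_dist
  by (simp_all add: norm_metric_def Metric_space.mspace_metric Metric_space.mdist_metric)

locale banach_space = normed_space +
  assumes complete: "mcomplete_of (norm_metric E)"

definition finite_dimensional ::
    "('k::{real_normed_field, banach}, 'a) nspace \<Rightarrow> bool" where
  "finite_dimensional E \<longleftrightarrow>
     (\<exists>S. finite S \<and> S \<subseteq> carrier E \<and>
        (\<forall>x\<in>carrier E. \<exists>c. x = (\<Oplus>\<^bsub>E\<^esub>v\<in>S. c v \<odot>\<^bsub>E\<^esub> v)))"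

text \<open>Maps between spaces are \<open>extensional\<close>, so that equality of maps is equality on the domain.\<close>

definition bounded_operators ::
    "('k::{real_normed_field, banach}, 'a) nspace \<Rightarrow> ('k, 'b) nspace \<Rightarrow> ('a \<Rightarrow> 'b) set" where
  "bounded_operators E F =
     {B \<in> carrier E \<rightarrow>\<^sub>E carrier F.
        (\<forall>x\<in>carrier E. \<forall>y\<in>carrier E. B (x \<oplus>\<^bsub>E\<^esub> y) = B x \<oplus>\<^bsub>F\<^esub> B y) \<and>
        (\<forall>c. \<forall>x\<in>carrier E. B (c \<odot>\<^bsub>E\<^esub> x) = c \<odot>\<^bsub>F\<^esub> B x) \<and>
        (\<exists>C. \<forall>x\<in>carrier E. vnorm F (B x) \<le> C * vnorm E x)}"

definition isomorphic ::
    "('k::{real_normed_field, banach}, 'a) nspace \<Rightarrow> ('k, 'b) nspace \<Rightarrow> bool" where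
  "isomorphic E F \<longleftrightarrow>
     (\<exists>T\<in>bounded_operators E F. \<exists>S\<in>bounded_operators F E.
        (\<forall>x\<in>carrier E. S (T x) = x) \<and> (\<forall>y\<in>carrier F. T (S y) = y))"

definition complemented_subspace ::
    "'a set \<Rightarrow> ('k::{real_normed_field, banach}, 'a) nspace \<Rightarrow> bool" where
  "complemented_subspace N M \<longleftrightarrow>
     (\<exists>P\<in>bounded_operators M M. (\<forall>x\<in>carrier M. P (P x) = P x) \<and> N = P ` carrier M)"

definition prod_nspace ::
    "('k, 'a) nspace \<Rightarrow> ('k, 'b) nspace \<Rightarrow> ('k, 'a \<times> 'b) nspace" where
  "prod_nspace E F =
     \<lparr>carrier = carrier E \<times> carrier F,
      mult = undefined,
      one = undefined,
      zero = (\<zero>\<^bsub>E\<^esub>, \<zero>\<^bsub>F\<^esub>),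
      add = (\<lambda>(x, y) (x', y'). (x \<oplus>\<^bsub>E\<^esub> x', y \<oplus>\<^bsub>F\<^esub> y')),
      smult = (\<lambda>c (x, y). (c \<odot>\<^bsub>E\<^esub> x, c \<odot>\<^bsub>F\<^esub> y)),
      vnorm = (\<lambda>(x, y). max (vnorm E x) (vnorm F y))\<rparr>"

text \<open>
  The product of two spaces over \<open>'u\<close> lives over \<open>'u \<times> 'u\<close>, so membership of the product is
  expressed through its isomorphic copies over \<open>'u\<close>.  This is the same thing, since a space ideal
  is closed under isomorphism (every space is complemented in itself), and such copies always exist:
  either \<open>'u\<close> is infinite and in bijection with \<open>'u \<times> 'u\<close>, or all spaces over \<open>'u\<close> are zero.
  For the same reason the choice of the product norm is immaterial.
\<close>

definition space_ideal :: "('k::{real_normed_field, banach}, 'u) nspace set \<Rightarrow> bool" where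
  "space_ideal A \<longleftrightarrow>
     (\<forall>E\<in>A. banach_space E) \<and>
     (\<forall>E. banach_space E \<and> finite_dimensional E \<longrightarrow> E \<in> A) \<and>
     (\<forall>E1\<in>A. \<forall>E2\<in>A. \<forall>E. banach_space E \<and> isomorphic E (prod_nspace E1 E2) \<longrightarrow> E \<in> A) \<and>
     (\<forall>M\<in>A. \<forall>N E. complemented_subspace N M \<and> banach_space E \<and>
        isomorphic E (M\<lparr>carrier := N\<rparr>) \<longrightarrow> E \<in> A)"

type_synonym 'a pmetric = "'a metric \<times> 'a"

definition pointed_metric_space :: "'a pmetric \<Rightarrow> bool" where
  "pointed_metric_space X \<longleftrightarrow> snd X \<in> mspace (fst X)"

definition pointed :: "('k, 'a) nspace \<Rightarrow> 'a pmetric" where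
  "pointed E = (norm_metric E, \<zero>\<^bsub>E\<^esub>)"

definition Lip :: "'a pmetric \<Rightarrow> 'b pmetric \<Rightarrow> ('a \<Rightarrow> 'b) set" where
  "Lip X Y =
     {T \<in> extensional (mspace (fst X)).
        Lipschitz_continuous_map (fst X) (fst Y) T \<and> T (snd X) = snd Y}"

definition Lip_dual :: "'a pmetric \<Rightarrow> ('a \<Rightarrow> 'k::{real_normed_field, banach}) set" where
  "Lip_dual X = Lip X (euclidean_metric, 0)"

type_synonym ('k, 'm, 'u) op_class = "'m pmetric \<Rightarrow> ('k, 'u) nspace \<Rightarrow> ('m \<Rightarrow> 'u) set"

definition nonlinear_ideal ::
    "('k::{real_normed_field, banach}, 'm, 'u) op_class \<Rightarrow> bool" where
  "nonlinear_ideal AL \<longleftrightarrow>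
     (\<forall>X F. pointed_metric_space X \<and> banach_space F \<longrightarrow>
        AL X F \<subseteq> Lip X (pointed F) \<and>
        (\<forall>g\<in>Lip_dual X. \<forall>e\<in>carrier F. (\<lambda>x\<in>mspace (fst X). g x \<odot>\<^bsub>F\<^esub> e) \<in> AL X F) \<and>
        (\<forall>S\<in>AL X F. \<forall>T\<in>AL X F. (\<lambda>x\<in>mspace (fst X). S x \<oplus>\<^bsub>F\<^esub> T x) \<in> AL X F) \<and>
        (\<forall>X0 F0. pointed_metric_space X0 \<and> banach_space F0 \<longrightarrow>
           (\<forall>A\<in>Lip X0 X. \<forall>T\<in>AL X F. \<forall>B\<in>bounded_operators F F0.
              (\<lambda>x\<in>mspace (fst X0). B (T (A x))) \<in> AL X0 F0)))"

definition factorable ::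
    "('k::{real_normed_field, banach}, 'u) nspace set \<Rightarrow> 'm pmetric \<Rightarrow> ('k, 'u) nspace \<Rightarrow>
      ('m \<Rightarrow> 'u) \<Rightarrow> bool" where
  "factorable \<A> X F T \<longleftrightarrow>
     (\<exists>M\<in>\<A>. \<exists>A\<in>Lip X (pointed M). \<exists>B\<in>bounded_operators M F.
        T = (\<lambda>x\<in>mspace (fst X). B (A x)))"

definition OpL ::
    "('k::{real_normed_field, banach}, 'u) nspace set \<Rightarrow> ('k, 'm, 'u) op_class" where
  "OpL \<A> X F = {T \<in> Lip X (pointed F). factorable \<A> X F T}"

end

theory Submission
  imports Defs
begin

text \<open>
  Factorizations can be built from given ones, and the axioms of a space ideal admit the new middle
  spaces.

  \<^item> The operator \<open>x \<mapsto> g x \<odot> e\<close> takes its values in the line through \<open>e\<close>. That line is finite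
    dimensional, and it is complete because the scalar field is; so it belongs to every space ideal
    (\<open>OpL_elementary\<close>).
  \<^item> If \<open>T\<^sub>1 = B\<^sub>1 S\<^sub>1\<close> and \<open>T\<^sub>2 = B\<^sub>2 S\<^sub>2\<close> factor through \<open>M\<^sub>1\<close> and \<open>M\<^sub>2\<close>, then \<open>T\<^sub>1 + T\<^sub>2\<close> factors through
    \<open>M\<^sub>1 \<times> M\<^sub>2\<close>, as \<open>x \<mapsto> (S\<^sub>1 x, S\<^sub>2 x)\<close> followed by \<open>(u, v) \<mapsto> B\<^sub>1 u + B\<^sub>2 v\<close> (\<open>OpL_add\<close>).
  \<^item> If \<open>T = B S\<^sub>1\<close>, then \<open>R T S = (R B) (S\<^sub>1 S)\<close> factors through the same space as \<open>T\<close>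
    (\<open>OpL_compose\<close>).

  The sum needs care, because a space ideal over \<open>'u\<close> contains only isomorphic copies over \<open>'u\<close> of the
  product, which itself lives over \<open>'u \<times> 'u\<close>. Such a copy is obtained by transporting the structure
  along a map into \<open>'u\<close> that is injective on the carrier of the product; \<open>ex_inj_on_prod_carriers\<close>
  provides the map.

  The line, the product and its copy must be shown complete. Each is a Lipschitz retract of a complete
  metric space, which suffices (\<open>mcomplete_of_Lipschitz_retract\<close>).
\<close>

section \<open>Normed spaces and bounded operators\<close>

lemma ring_of_type_algebra_sel [simp]:
  "carrier ring_of_type_algebra = UNIV"
  "zero ring_of_type_algebra = 0"
  "one ring_of_type_algebra = 1"
  "add ring_of_type_algebra a b = a + b"
  "mult ring_of_type_algebra a b = a * b"
  by (simp_all add: ring_of_type_algebra_def)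

context normed_space
begin

lemma scale_closed: "x \<in> carrier E \<Longrightarrow> c \<odot> x \<in> carrier E"
  and scale_add_left: "x \<in> carrier E \<Longrightarrow> (c + d) \<odot> x = c \<odot> x \<oplus> d \<odot> x"
  and scale_add_right: "x \<in> carrier E \<Longrightarrow> y \<in> carrier E \<Longrightarrow> c \<odot> (x \<oplus> y) = c \<odot> x \<oplus> c \<odot> y"
  and scale_scale: "x \<in> carrier E \<Longrightarrow> (c * d) \<odot> x = c \<odot> (d \<odot> x)"
  and scale_1: "x \<in> carrier E \<Longrightarrow> 1 \<odot> x = x"
  and scale_0: "x \<in> carrier E \<Longrightarrow> 0 \<odot> x = \<zero>"
  using smult_closed[of c x] smult_l_distr[of c d x] smult_r_distr[of c x y]
    smult_assoc1[of c d x] smult_one[of x] smult_l_null[of x]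
  by simp_all

text \<open>
  Negation in \<open>E\<close> is a description over the carrier. Trading it for multiplication by \<open>- 1\<close> lets
  distances be compared between spaces that share operations but differ in carrier, and moved along
  linear maps.
\<close>

lemma minus_eq_scale:
  assumes "x \<in> carrier E" "y \<in> carrier E"
  shows "x \<ominus> y = x \<oplus> (- 1) \<odot> y"
proof -
  have "(- 1) \<odot> y \<oplus> y = \<zero>"
    using scale_add_left[of y "- 1" 1] assms by (simp add: scale_0 scale_1)
  then have "\<ominus> y = (- 1) \<odot> y"
    using assms by (simp add: M.minus_equality scale_closed)
  then show ?thesis
    by (simp add: M.minus_eq)
qed

lemma norm_dist_eq:
  "x \<in> carrier E \<Longrightarrow> y \<in> carrier E \<Longrightarrow> norm_dist E x y = vnorm E (x \<oplus> (- 1) \<odot> y)"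
  by (simp add: norm_dist_def minus_eq_scale)

lemma norm_dist_scale:
  assumes "x \<in> carrier E"
  shows "norm_dist E (c \<odot> x) (d \<odot> x) = norm (c - d) * vnorm E x"
proof -
  have "c \<odot> x \<oplus> (- 1) \<odot> (d \<odot> x) = (c - d) \<odot> x"
    using assms scale_add_left[of x c "- d"] scale_scale[of x "- 1" d] by simp
  then show ?thesis
    using assms by (simp add: norm_dist_eq scale_closed vnorm_smult)
qed

end

text \<open>
  Additive inverses come for free: \<open>0 \<odot> x\<close> has norm \<open>0\<close>, hence is the zero vector, and so
  \<open>(- 1) \<odot> x\<close> is inverse to \<open>x\<close>.
\<close>

lemma normed_spaceI:
  fixes E :: "('k::{real_normed_field, banach}, 'a) nspace" (structure)
  assumes add_closed: "\<And>x y. x \<in> carrier E \<Longrightarrow> y \<in> carrier E \<Longrightarrow> x \<oplus> y \<in> carrier E"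
    and zero_closed: "\<zero> \<in> carrier E"
    and add_assoc: "\<And>x y z. x \<in> carrier E \<Longrightarrow> y \<in> carrier E \<Longrightarrow> z \<in> carrier E \<Longrightarrow>
        (x \<oplus> y) \<oplus> z = x \<oplus> (y \<oplus> z)"
    and add_commute: "\<And>x y. x \<in> carrier E \<Longrightarrow> y \<in> carrier E \<Longrightarrow> x \<oplus> y = y \<oplus> x"
    and zero_add: "\<And>x. x \<in> carrier E \<Longrightarrow> \<zero> \<oplus> x = x"
    and scale_closed: "\<And>c x. x \<in> carrier E \<Longrightarrow> c \<odot> x \<in> carrier E"
    and scale_add_left: "\<And>c d x. x \<in> carrier E \<Longrightarrow> (c + d) \<odot> x = c \<odot> x \<oplus> d \<odot> x"
    and scale_add_right: "\<And>c x y. x \<in> carrier E \<Longrightarrow> y \<in> carrier E \<Longrightarrow>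
        c \<odot> (x \<oplus> y) = c \<odot> x \<oplus> c \<odot> y"
    and scale_scale: "\<And>c d x. x \<in> carrier E \<Longrightarrow> (c * d) \<odot> x = c \<odot> (d \<odot> x)"
    and scale_1: "\<And>x. x \<in> carrier E \<Longrightarrow> 1 \<odot> x = x"
    and norm_nonneg: "\<And>x. x \<in> carrier E \<Longrightarrow> 0 \<le> vnorm E x"
    and norm_eq_0: "\<And>x. x \<in> carrier E \<Longrightarrow> vnorm E x = 0 \<longleftrightarrow> x = \<zero>"
    and norm_triangle: "\<And>x y. x \<in> carrier E \<Longrightarrow> y \<in> carrier E \<Longrightarrow>
        vnorm E (x \<oplus> y) \<le> vnorm E x + vnorm E y"
    and norm_scale: "\<And>c x. x \<in> carrier E \<Longrightarrow> vnorm E (c \<odot> x) = norm c * vnorm E x"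
  shows "normed_space E"
proof -
  have inverse: "\<exists>y\<in>carrier E. y \<oplus> x = \<zero>" if x: "x \<in> carrier E" for x
  proof
    have "(- 1) \<odot> x \<oplus> x = 0 \<odot> x"
      using scale_add_left[OF x, of "- 1" 1] by (simp add: scale_1 x)
    also have "\<dots> = \<zero>"
      using norm_eq_0[OF scale_closed[OF x, of 0]] norm_scale[OF x, of 0] by simp
    finally show "(- 1) \<odot> x \<oplus> x = \<zero>" .
    show "(- 1) \<odot> x \<in> carrier E"
      by (rule scale_closed[OF x])
  qed
  have "abelian_group E"
    by (rule abelian_groupI[OF add_closed zero_closed add_assoc add_commute zero_add inverse])
  then have "module (ring_of_type_algebra :: 'k ring) E"
    by (intro moduleI cring_from_type_algebra)
      (simp_all add: scale_closed scale_add_left scale_add_right scale_scale scale_1)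
  then show ?thesis
    by (intro normed_space.intro normed_space_axioms.intro norm_nonneg norm_eq_0
        norm_triangle norm_scale)
qed

lemma bounded_operatorsI:
  assumes "B \<in> carrier E \<rightarrow>\<^sub>E carrier F"
    and "\<And>x y. x \<in> carrier E \<Longrightarrow> y \<in> carrier E \<Longrightarrow> B (x \<oplus>\<^bsub>E\<^esub> y) = B x \<oplus>\<^bsub>F\<^esub> B y"
    and "\<And>c x. x \<in> carrier E \<Longrightarrow> B (c \<odot>\<^bsub>E\<^esub> x) = c \<odot>\<^bsub>F\<^esub> B x"
    and "\<And>x. x \<in> carrier E \<Longrightarrow> vnorm F (B x) \<le> C * vnorm E x"
  shows "B \<in> bounded_operators E F"
  using assms unfolding bounded_operators_def by blast

lemma bounded_operatorsD:
  assumes "B \<in> bounded_operators E F"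
  shows "B \<in> extensional (carrier E)"
    and "\<And>x. x \<in> carrier E \<Longrightarrow> B x \<in> carrier F"
    and "\<And>x y. x \<in> carrier E \<Longrightarrow> y \<in> carrier E \<Longrightarrow> B (x \<oplus>\<^bsub>E\<^esub> y) = B x \<oplus>\<^bsub>F\<^esub> B y"
    and "\<And>c x. x \<in> carrier E \<Longrightarrow> B (c \<odot>\<^bsub>E\<^esub> x) = c \<odot>\<^bsub>F\<^esub> B x"
  using assms unfolding bounded_operators_def PiE_iff by blast+

text \<open>
  The bound in \<open>bounded_operators\<close> may be negative, namely when the domain is zero; chaining bounds
  needs a nonnegative one.
\<close>

lemma bounded_operators_bound:
  assumes "normed_space E" "B \<in> bounded_operators E F"
  obtains C where "0 \<le> C" "\<And>x. x \<in> carrier E \<Longrightarrow> vnorm F (B x) \<le> C * vnorm E x"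
proof -
  obtain C where C: "\<And>x. x \<in> carrier E \<Longrightarrow> vnorm F (B x) \<le> C * vnorm E x"
    using assms(2) unfolding bounded_operators_def by blast
  show ?thesis
  proof (rule that[of "max 0 C"])
    fix x
    assume x: "x \<in> carrier E"
    have "C * vnorm E x \<le> max 0 C * vnorm E x"
      using normed_space.vnorm_nonneg[OF assms(1) x] by (intro mult_right_mono) auto
    then show "vnorm F (B x) \<le> max 0 C * vnorm E x"
      using C[OF x] by linarith
  qed simp
qed

lemma bounded_operators_compose:
  assumes "normed_space E" "normed_space F"
    and "S \<in> bounded_operators E F" "T \<in> bounded_operators F G"
  shows "(\<lambda>x\<in>carrier E. T (S x)) \<in> bounded_operators E G"
proof -
  interpret E: normed_space E by fact
  note S = bounded_operatorsD[OF assms(3)] and T = bounded_operatorsD[OF assms(4)]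
  obtain C where C: "0 \<le> C" "\<And>x. x \<in> carrier E \<Longrightarrow> vnorm F (S x) \<le> C * vnorm E x"
    using bounded_operators_bound[OF assms(1,3)] by blast
  obtain D where D: "0 \<le> D" "\<And>x. x \<in> carrier F \<Longrightarrow> vnorm G (T x) \<le> D * vnorm F x"
    using bounded_operators_bound[OF assms(2,4)] by blast
  show ?thesis
  proof (rule bounded_operatorsI[where C = "D * C"])
    fix x
    assume x: "x \<in> carrier E"
    have "vnorm G (T (S x)) \<le> D * vnorm F (S x)"
      using S(2) x D(2) by blast
    also have "\<dots> \<le> D * (C * vnorm E x)"
      using C(2) x D(1) by (intro mult_left_mono)
    finally show "vnorm G ((\<lambda>x\<in>carrier E. T (S x)) x) \<le> D * C * vnorm E x"
      using x by (simp add: mult.assoc)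
  qed (auto simp: S T E.scale_closed)
qed

lemma bounded_operators_add:
  assumes "normed_space E" "normed_space F"
    and "S \<in> bounded_operators E F" "T \<in> bounded_operators E F"
  shows "(\<lambda>x\<in>carrier E. S x \<oplus>\<^bsub>F\<^esub> T x) \<in> bounded_operators E F"
proof -
  interpret E: normed_space E by fact
  interpret F: normed_space F by fact
  note S = bounded_operatorsD[OF assms(3)] and T = bounded_operatorsD[OF assms(4)]
  obtain C where C: "\<And>x. x \<in> carrier E \<Longrightarrow> vnorm F (S x) \<le> C * vnorm E x"
    using bounded_operators_bound[OF assms(1,3)] by blast
  obtain D where D: "\<And>x. x \<in> carrier E \<Longrightarrow> vnorm F (T x) \<le> D * vnorm E x"
    using bounded_operators_bound[OF assms(1,4)] by blast
  show ?thesis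
  proof (rule bounded_operatorsI[where C = "C + D"])
    fix x
    assume x: "x \<in> carrier E"
    have "vnorm F (S x \<oplus>\<^bsub>F\<^esub> T x) \<le> vnorm F (S x) + vnorm F (T x)"
      using x by (intro F.vnorm_triangle S T)
    then show "vnorm F ((\<lambda>x\<in>carrier E. S x \<oplus>\<^bsub>F\<^esub> T x) x) \<le> (C + D) * vnorm E x"
      using x C[OF x] D[OF x] by (simp add: distrib_right)
  qed (auto simp: S T E.scale_closed F.scale_add_right F.M.a_ac)
qed

section \<open>Lipschitz maps and completeness\<close>

lemma Lip_compose:
  assumes "A \<in> Lip X Y" "B \<in> Lip Y Z" "pointed_metric_space X"
  shows "(\<lambda>x\<in>mspace (fst X). B (A x)) \<in> Lip X Z"
proof -
  have "Lipschitz_continuous_map (fst X) (fst Z) (B \<circ> A)"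
    using assms Lipschitz_continuous_map_compose unfolding Lip_def by blast
  then have "Lipschitz_continuous_map (fst X) (fst Z) (\<lambda>x\<in>mspace (fst X). B (A x))"
    by (rule Lipschitz_continuous_map_eq) simp
  then show ?thesis
    using assms unfolding Lip_def pointed_metric_space_def by simp
qed

lemma Lip_pointed_closed:
  assumes "normed_space E" "T \<in> Lip X (pointed E)" "x \<in> mspace (fst X)"
  shows "T x \<in> carrier E"
  using assms normed_space.mspace_norm_metric[OF assms(1)]
  by (auto simp: Lip_def pointed_def Lipschitz_continuous_map_def)

lemma bounded_operators_subset_Lip:
  assumes "normed_space E" "normed_space F"
  shows "bounded_operators E F \<subseteq> Lip (pointed E) (pointed F)"
proof
  fix B
  assume B_op: "B \<in> bounded_operators E F"
  interpret E: normed_space E by fact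
  interpret F: normed_space F by fact
  note B = bounded_operatorsD[OF B_op]
  obtain C where C: "\<And>x. x \<in> carrier E \<Longrightarrow> vnorm F (B x) \<le> C * vnorm E x"
    using bounded_operators_bound[OF assms(1) B_op] by blast
  have "norm_dist F (B x) (B y) \<le> C * norm_dist E x y"
    if "x \<in> carrier E" "y \<in> carrier E" for x y
    using that C[of "x \<oplus>\<^bsub>E\<^esub> (- 1) \<odot>\<^bsub>E\<^esub> y"]
    by (simp add: E.norm_dist_eq F.norm_dist_eq B E.scale_closed)
  moreover have "B \<zero>\<^bsub>E\<^esub> = \<zero>\<^bsub>F\<^esub>"
    using B(4)[of "\<zero>\<^bsub>E\<^esub>" 0] B(2)[of "\<zero>\<^bsub>E\<^esub>"] by (simp add: E.scale_0 F.scale_0)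
  ultimately show "B \<in> Lip (pointed E) (pointed F)"
    using B by (auto simp: Lip_def pointed_def Lipschitz_continuous_map_def)
qed

text \<open>
  A Cauchy sequence in the retract \<open>m2\<close> is carried into \<open>m1\<close> by the section \<open>g\<close>, converges there, and
  is brought back by \<open>f\<close>.
\<close>

lemma mcomplete_of_Lipschitz_retract:
  assumes "mcomplete_of m1"
    and f: "Lipschitz_continuous_map m1 m2 f" and g: "Lipschitz_continuous_map m2 m1 g"
    and fg: "\<And>y. y \<in> mspace m2 \<Longrightarrow> f (g y) = y"
  shows "mcomplete_of m2"
proof -
  interpret M1: Metric_space "mspace m1" "mdist m1"
    by (rule Metric_space_mspace_mdist)
  interpret M2: Metric_space "mspace m2" "mdist m2"
    by (rule Metric_space_mspace_mdist)
  show ?thesis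
    unfolding mcomplete_of_def M2.mcomplete_def
  proof (intro allI impI)
    fix \<sigma>
    assume \<sigma>: "M2.MCauchy \<sigma>"
    then have "M1.MCauchy (g \<circ> \<sigma>)"
      using Lipschitz_imp_Cauchy_continuous_map[OF g] unfolding Cauchy_continuous_map_def by blast
    then obtain x where "limitin M1.mtopology (g \<circ> \<sigma>) x sequentially"
      using assms(1) unfolding mcomplete_of_def M1.mcomplete_def by blast
    then have "limitin M2.mtopology (f \<circ> (g \<circ> \<sigma>)) (f x) sequentially"
      by (rule continuous_map_limit
          [OF Lipschitz_continuous_imp_continuous_map[OF f, unfolded mtopology_of_def]])
    moreover have "f \<circ> (g \<circ> \<sigma>) = \<sigma>"
      using \<sigma> fg unfolding M2.MCauchy_def by (simp add: fun_eq_iff image_subset_iff)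
    ultimately show "\<exists>y. limitin M2.mtopology \<sigma> y sequentially"
      by auto
  qed
qed

lemma banach_space_isomorphic:
  assumes "banach_space E" "normed_space F" "isomorphic F E"
  shows "banach_space F"
proof -
  interpret E: banach_space E by fact
  interpret F: normed_space F by fact
  obtain T S where T: "T \<in> bounded_operators F E" and S: "S \<in> bounded_operators E F"
    and ST: "\<forall>x\<in>carrier F. S (T x) = x"
    using assms(3) unfolding isomorphic_def by blast
  have "Lipschitz_continuous_map (norm_metric F) (norm_metric E) T"
    "Lipschitz_continuous_map (norm_metric E) (norm_metric F) S"
    using bounded_operators_subset_Lip[of F E] bounded_operators_subset_Lip[of E F] S T
      E.normed_space_axioms F.normed_space_axioms
    by (auto simp: Lip_def pointed_def)
  then have "mcomplete_of (norm_metric F)"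
    using ST E.complete by (intro mcomplete_of_Lipschitz_retract[of "norm_metric E" _ S T]) auto
  then show ?thesis
    using F.normed_space_axioms by (intro banach_space.intro banach_space_axioms.intro)
qed

section \<open>The line through a vector\<close>

definition line :: "('k::{real_normed_field, banach}, 'a) nspace \<Rightarrow> 'a \<Rightarrow> ('k, 'a) nspace" where
  "line E e = E\<lparr>carrier := range (\<lambda>c. c \<odot>\<^bsub>E\<^esub> e)\<rparr>"

context normed_space
begin

lemma carrier_line: "carrier (line E e) = range (\<lambda>c. c \<odot> e)"
  by (simp add: line_def)

lemma carrier_line_subset: "e \<in> carrier E \<Longrightarrow> carrier (line E e) \<subseteq> carrier E"
  by (auto simp: carrier_line scale_closed)

lemma normed_space_line:
  assumes e: "e \<in> carrier E"
  shows "normed_space (line E e)"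
proof (rule normed_spaceI)
  show "\<zero>\<^bsub>line E e\<^esub> \<in> carrier (line E e)"
    using scale_0[OF e] by (auto simp: line_def intro: range_eqI[of _ _ 0])
next
  fix x y
  assume "x \<in> carrier (line E e)" "y \<in> carrier (line E e)"
  then show "x \<oplus>\<^bsub>line E e\<^esub> y \<in> carrier (line E e)"
    using scale_add_left[OF e] by (auto simp: line_def image_iff) metis
next
  fix c x
  assume "x \<in> carrier (line E e)"
  then show "c \<odot>\<^bsub>line E e\<^esub> x \<in> carrier (line E e)"
    using scale_scale[OF e] by (auto simp: line_def image_iff) metis
qed (use e in \<open>auto simp: line_def scale_closed scale_add_left scale_add_right
      scale_scale scale_1 scale_0 vnorm_nonneg vnorm_eq_0_iff vnorm_smult M.a_ac
      intro!: order_trans[OF vnorm_triangle]\<close>)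

lemma norm_dist_line:
  assumes e: "e \<in> carrier E"
  shows "norm_dist (line E e) (c \<odot> e) (d \<odot> e) = norm (c - d) * vnorm E e"
proof -
  interpret L: normed_space "line E e" by (rule normed_space_line[OF e])
  have "norm_dist (line E e) (c \<odot> e) (d \<odot> e) = norm_dist E (c \<odot> e) (d \<odot> e)"
    by (subst L.norm_dist_eq) (auto simp: line_def norm_dist_eq scale_closed[OF e])
  then show ?thesis
    by (simp add: norm_dist_scale[OF e])
qed

lemma Lipschitz_continuous_map_scale:
  assumes e: "e \<in> carrier E"
  shows "Lipschitz_continuous_map euclidean_metric (norm_metric (line E e)) (\<lambda>c. c \<odot> e)"
proof -
  interpret L: normed_space "line E e" by (rule normed_space_line[OF e])
  show ?thesis
    unfolding Lipschitz_continuous_map_def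
    by (auto simp: carrier_line norm_dist_line[OF e] dist_norm mult.commute intro!: exI[of _ "vnorm E e"])
qed

lemma banach_space_line:
  assumes e: "e \<in> carrier E"
  shows "banach_space (line E e)"
proof -
  interpret L: normed_space "line E e" by (rule normed_space_line[OF e])
  \<comment> \<open>The inverse of \<open>c \<mapsto> c \<odot> e\<close>. For \<open>e = \<zero>\<close> every scalar is a preimage of \<open>\<zero>\<close>, and a constant
    choice makes \<open>g\<close> Lipschitz with the constant \<open>inverse 0 = 0\<close>.\<close>
  define g where "g y = (if e = \<zero> then 0 else SOME c. y = c \<odot> e)" for y
  have fg: "g y \<odot> e = y" if "y \<in> carrier (line E e)" for y
  proof (cases "e = \<zero>")
    case True
    then show ?thesis
      using that scale_0[OF e] smult_r_null by (auto simp: g_def carrier_line)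
  next
    case False
    then show ?thesis
      using that someI_ex[of "\<lambda>c. y = c \<odot> e"] unfolding g_def carrier_line by (simp add: image_iff)
  qed
  have "dist (g x) (g y) \<le> inverse (vnorm E e) * norm_dist (line E e) x y"
    if "x \<in> carrier (line E e)" "y \<in> carrier (line E e)" for x y
  proof (cases "e = \<zero>")
    case True
    then show ?thesis
      using vnorm_eq_0_iff[OF e] by (simp add: g_def)
  next
    case False
    then have "vnorm E e \<noteq> 0"
      using vnorm_eq_0_iff[OF e] by simp
    then show ?thesis
      using norm_dist_line[OF e, of "g x" "g y"] fg that by (simp add: dist_norm field_simps)
  qed
  then have "Lipschitz_continuous_map (norm_metric (line E e)) euclidean_metric g"
    unfolding Lipschitz_continuous_map_def by auto
  moreover have "mcomplete_of (euclidean_metric :: 'k metric)"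
    by (simp add: mcomplete_of_def complete_UNIV)
  ultimately have "mcomplete_of (norm_metric (line E e))"
    using fg by (intro mcomplete_of_Lipschitz_retract[OF _ Lipschitz_continuous_map_scale[OF e]]) auto
  then show ?thesis
    using L.normed_space_axioms by (intro banach_space.intro banach_space_axioms.intro)
qed

lemma finite_dimensional_line:
  assumes e: "e \<in> carrier E"
  shows "finite_dimensional (line E e)"
proof -
  interpret L: normed_space "line E e" by (rule normed_space_line[OF e])
  have eL: "e \<in> carrier (line E e)"
    using scale_1[OF e] unfolding carrier_line by (metis rangeI)
  have "\<exists>c. x = (\<Oplus>\<^bsub>line E e\<^esub>v\<in>{e}. c v \<odot>\<^bsub>line E e\<^esub> v)" if x: "x \<in> carrier (line E e)" for x
  proof -
    obtain c where "x = c \<odot> e"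
      using x by (auto simp: carrier_line)
    then have "x = c \<odot>\<^bsub>line E e\<^esub> e"
      by (simp add: line_def)
    then show ?thesis
      using x by (intro exI[of _ "\<lambda>_. c"], subst L.M.finsum_insert) auto
  qed
  then show ?thesis
    unfolding finite_dimensional_def using eL by (intro exI[of _ "{e}"]) auto
qed

lemma line_inclusion:
  assumes e: "e \<in> carrier E"
  shows "(\<lambda>x\<in>carrier (line E e). x) \<in> bounded_operators (line E e) E"
proof -
  interpret L: normed_space "line E e" by (rule normed_space_line[OF e])
  show ?thesis
    by (rule bounded_operatorsI[where C = 1])
      (use carrier_line_subset[OF e] L.M.a_closed L.scale_closed in
        \<open>auto simp: line_def\<close>)
qed

end

section \<open>Products and their copies\<close>

lemma prod_nspace_sel [simp]:
  "carrier (prod_nspace E F) = carrier E \<times> carrier F"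
  "\<zero>\<^bsub>prod_nspace E F\<^esub> = (\<zero>\<^bsub>E\<^esub>, \<zero>\<^bsub>F\<^esub>)"
  "(x, y) \<oplus>\<^bsub>prod_nspace E F\<^esub> (x', y') = (x \<oplus>\<^bsub>E\<^esub> x', y \<oplus>\<^bsub>F\<^esub> y')"
  "c \<odot>\<^bsub>prod_nspace E F\<^esub> (x, y) = (c \<odot>\<^bsub>E\<^esub> x, c \<odot>\<^bsub>F\<^esub> y)"
  "vnorm (prod_nspace E F) (x, y) = max (vnorm E x) (vnorm F y)"
  by (simp_all add: prod_nspace_def)

lemma normed_space_prod_nspace:
  assumes "normed_space E" "normed_space F"
  shows "normed_space (prod_nspace E F)"
proof -
  interpret E: normed_space E by fact
  interpret F: normed_space F by fact
  show ?thesis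
  proof (rule normed_spaceI)
    fix z
    assume z: "z \<in> carrier (prod_nspace E F)"
    then show "vnorm (prod_nspace E F) z = 0 \<longleftrightarrow> z = \<zero>\<^bsub>prod_nspace E F\<^esub>"
      using E.vnorm_nonneg F.vnorm_nonneg E.vnorm_eq_0_iff F.vnorm_eq_0_iff
      by (cases z) (fastforce simp: max_def split: if_splits)
  next
    fix z w
    assume "z \<in> carrier (prod_nspace E F)" "w \<in> carrier (prod_nspace E F)"
    then show "vnorm (prod_nspace E F) (z \<oplus>\<^bsub>prod_nspace E F\<^esub> w)
        \<le> vnorm (prod_nspace E F) z + vnorm (prod_nspace E F) w"
      using E.vnorm_triangle[of "fst z" "fst w"] F.vnorm_triangle[of "snd z" "snd w"]
      by (cases z; cases w) auto
  qed (auto simp: E.scale_closed F.scale_closed E.scale_add_left F.scale_add_left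
      E.scale_add_right F.scale_add_right E.scale_scale F.scale_scale E.scale_1 F.scale_1
      E.vnorm_nonneg F.vnorm_nonneg E.vnorm_smult F.vnorm_smult E.M.a_ac F.M.a_ac
      max_mult_distrib_left le_max_iff_disj)
qed

lemma prod_nspace_projections:
  assumes "normed_space E" "normed_space F"
  shows "(\<lambda>z\<in>carrier (prod_nspace E F). fst z) \<in> bounded_operators (prod_nspace E F) E"
    and "(\<lambda>z\<in>carrier (prod_nspace E F). snd z) \<in> bounded_operators (prod_nspace E F) F"
proof -
  interpret E: normed_space E by fact
  interpret F: normed_space F by fact
  show "(\<lambda>z\<in>carrier (prod_nspace E F). fst z) \<in> bounded_operators (prod_nspace E F) E"
    "(\<lambda>z\<in>carrier (prod_nspace E F). snd z) \<in> bounded_operators (prod_nspace E F) F"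
    by (rule bounded_operatorsI[where C = 1]; auto simp: E.scale_closed F.scale_closed)+
qed

text \<open>
  \<open>prod_metric\<close> is the Euclidean combination of the two distances, while the product norm is their
  maximum; the latter is the smaller one. Comparing the two gives access to the known facts on
  completeness of \<open>prod_metric\<close> and on pairs of Lipschitz maps.
\<close>

lemma Lipschitz_continuous_map_into_prod_nspace:
  assumes "normed_space E" "normed_space F"
  shows "Lipschitz_continuous_map (prod_metric (norm_metric E) (norm_metric F))
    (norm_metric (prod_nspace E F)) (\<lambda>z. z)"
proof -
  interpret E: normed_space E by fact
  interpret F: normed_space F by fact
  interpret P: normed_space "prod_nspace E F"
    by (intro normed_space_prod_nspace assms)
  interpret EF: Metric_space12 "carrier E" "norm_dist E" "carrier F" "norm_dist F"
    by (intro Metric_space12.intro E.Metric_space_norm_dist F.Metric_space_norm_dist)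
  have "norm_dist (prod_nspace E F) (x, y) (x', y')
      \<le> prod_dist (norm_dist E) (norm_dist F) (x, y) (x', y')"
    if "x \<in> carrier E" "x' \<in> carrier E" "y \<in> carrier F" "y' \<in> carrier F" for x x' y y'
    using that EF.component_le_prod_metric(1)[of x x' y y']
      EF.component_le_prod_metric(2)[of y y' x x']
    by (simp add: P.norm_dist_eq E.norm_dist_eq F.norm_dist_eq)
  then show ?thesis
    unfolding Lipschitz_continuous_map_def by (auto intro!: exI[of _ 1])
qed

lemma banach_space_prod_nspace:
  assumes "banach_space E" "banach_space F"
  shows "banach_space (prod_nspace E F)"
proof -
  interpret E: banach_space E by fact
  interpret F: banach_space F by fact
  have norm: "normed_space E" "normed_space F" ..
  interpret P: normed_space "prod_nspace E F"
    by (intro normed_space_prod_nspace norm)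
  interpret EF: Metric_space12 "carrier E" "norm_dist E" "carrier F" "norm_dist F"
    by (intro Metric_space12.intro E.Metric_space_norm_dist F.Metric_space_norm_dist)
  let ?m = "prod_metric (norm_metric E) (norm_metric F)"
  have complete: "mcomplete_of ?m"
    using E.complete F.complete EF.mcomplete_prod_metric by (simp add: mcomplete_of_def)
  have "Lipschitz_continuous_map (norm_metric (prod_nspace E F)) (norm_metric E)
      (\<lambda>z\<in>carrier (prod_nspace E F). fst z)"
    "Lipschitz_continuous_map (norm_metric (prod_nspace E F)) (norm_metric F)
      (\<lambda>z\<in>carrier (prod_nspace E F). snd z)"
    using prod_nspace_projections[OF norm] bounded_operators_subset_Lip[OF P.normed_space_axioms]
      norm by (fastforce simp: Lip_def pointed_def)+
  then have "Lipschitz_continuous_map (norm_metric (prod_nspace E F)) ?m (\<lambda>z. z)"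
    unfolding Lipschitz_continuous_map_pairwise
    by (auto elim!: Lipschitz_continuous_map_eq)
  then have "mcomplete_of (norm_metric (prod_nspace E F))"
    by (rule mcomplete_of_Lipschitz_retract
        [OF complete Lipschitz_continuous_map_into_prod_nspace[OF norm]]) simp
  then show ?thesis
    using P.normed_space_axioms by (intro banach_space.intro banach_space_axioms.intro)
qed

lemma Lip_pair:
  assumes "normed_space E" "normed_space F"
    and "S \<in> Lip X (pointed E)" "T \<in> Lip X (pointed F)" "pointed_metric_space X"
  shows "(\<lambda>x\<in>mspace (fst X). (S x, T x)) \<in> Lip X (pointed (prod_nspace E F))"
proof -
  have "Lipschitz_continuous_map (fst X) (prod_metric (norm_metric E) (norm_metric F))
      (\<lambda>x. (S x, T x))"
    using assms(3,4) by (simp add: Lipschitz_continuous_map_paired Lip_def pointed_def)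
  then have "Lipschitz_continuous_map (fst X) (norm_metric (prod_nspace E F)) (\<lambda>x. (S x, T x))"
    using Lipschitz_continuous_map_compose Lipschitz_continuous_map_into_prod_nspace[OF assms(1,2)]
    by (fastforce simp: o_def)
  then have "Lipschitz_continuous_map (fst X) (norm_metric (prod_nspace E F))
      (\<lambda>x\<in>mspace (fst X). (S x, T x))"
    by (rule Lipschitz_continuous_map_eq) simp
  then show ?thesis
    using assms by (simp add: Lip_def pointed_def pointed_metric_space_def)
qed

text \<open>
  The structure on the image of \<open>E\<close> for which \<open>\<phi>\<close>, if injective on the carrier, is an isometric
  isomorphism.
\<close>

definition transport_nspace ::
    "('a \<Rightarrow> 'b) \<Rightarrow> ('k::{real_normed_field, banach}, 'a) nspace \<Rightarrow> ('k, 'b) nspace" where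
  "transport_nspace \<phi> E =
     (let \<psi> = the_inv_into (carrier E) \<phi> in
     \<lparr>carrier = \<phi> ` carrier E,
      mult = undefined,
      one = undefined,
      zero = \<phi> \<zero>\<^bsub>E\<^esub>,
      add = (\<lambda>u v. \<phi> (\<psi> u \<oplus>\<^bsub>E\<^esub> \<psi> v)),
      smult = (\<lambda>c u. \<phi> (c \<odot>\<^bsub>E\<^esub> \<psi> u)),
      vnorm = (\<lambda>u. vnorm E (\<psi> u))\<rparr>)"

lemma normed_space_transport_nspace:
  assumes "normed_space E" "inj_on \<phi> (carrier E)"
  shows "normed_space (transport_nspace \<phi> E)"
proof -
  interpret E: normed_space E by fact
  show ?thesis
    by (rule normed_spaceI)
      (auto simp: transport_nspace_def Let_def the_inv_into_f_f[OF assms(2)] inj_on_eq_iff[OF assms(2)]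
        E.scale_closed E.scale_add_left E.scale_add_right E.scale_scale E.scale_1
        E.vnorm_nonneg E.vnorm_eq_0_iff E.vnorm_triangle E.vnorm_smult E.M.a_ac)
qed

lemma isomorphic_transport_nspace:
  assumes "normed_space E" "inj_on \<phi> (carrier E)"
  shows "isomorphic (transport_nspace \<phi> E) E"
proof -
  interpret E: normed_space E by fact
  let ?F = "transport_nspace \<phi> E" and ?\<psi> = "the_inv_into (carrier E) \<phi>"
  note simps = transport_nspace_def Let_def the_inv_into_f_f[OF assms(2)] E.scale_closed
  have \<psi>: "restrict ?\<psi> (carrier ?F) \<in> bounded_operators ?F E"
    by (rule bounded_operatorsI[where C = 1]) (auto simp: simps dest: inj_onD[OF assms(2)])
  have \<phi>: "restrict \<phi> (carrier E) \<in> bounded_operators E ?F"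
    by (rule bounded_operatorsI[where C = 1]) (auto simp: simps)
  show ?thesis
    unfolding isomorphic_def by (rule bexI[OF _ \<psi>], rule bexI[OF _ \<phi>]) (auto simp: simps)
qed

text \<open>
  A nonzero vector spans a copy of the infinite scalar field. So either \<open>'u\<close> is infinite and in
  bijection with \<open>'u \<times> 'u\<close>, or both spaces are zero and so is their product.
\<close>

lemma ex_inj_on_prod_carriers:
  fixes E F :: "('k::{real_normed_field, banach}, 'u) nspace"
  assumes "normed_space E" "normed_space F"
  obtains \<phi> :: "'u \<times> 'u \<Rightarrow> 'u" where "inj_on \<phi> (carrier E \<times> carrier F)"
proof (cases "finite (UNIV :: 'u set)")
  case False
  then obtain \<phi> :: "'u \<times> 'u \<Rightarrow> 'u" where "bij_betw \<phi> (UNIV \<times> UNIV) UNIV"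
    using card_of_ordIso[THEN iffD2, OF card_of_Times_same_infinite] by blast
  then have "inj_on \<phi> (carrier E \<times> carrier F)"
    unfolding bij_betw_def by (auto intro: inj_on_subset)
  then show ?thesis
    by (rule that)
next
  case True
  have zero: "carrier G = {\<zero>\<^bsub>G\<^esub>}" if "normed_space G" for G :: "('k, 'u) nspace"
  proof -
    interpret G: normed_space G by fact
    have "x = \<zero>\<^bsub>G\<^esub>" if x: "x \<in> carrier G" for x
    proof (rule ccontr)
      assume "x \<noteq> \<zero>\<^bsub>G\<^esub>"
      then have "vnorm G x \<noteq> 0"
        using G.vnorm_eq_0_iff[OF x] by simp
      then have "inj (\<lambda>c :: 'k. c \<odot>\<^bsub>G\<^esub> x)"
        using G.norm_dist_scale[OF x] G.norm_dist_scale[OF x, of c c for c]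
        by (intro injI) (metis diff_self eq_iff_diff_eq_0 mult_eq_0_iff norm_eq_zero norm_zero)
      moreover have "infinite (UNIV :: 'k set)"
        by (rule infinite_UNIV_char_0)
      ultimately show False
        using True finite_imageD finite_subset subset_UNIV by metis
    qed
    then show ?thesis
      by auto
  qed
  show ?thesis
    by (rule that[of fst]) (simp add: zero assms inj_on_def)
qed

section \<open>Factorable operators\<close>

text \<open>
  Bounded operators are Lipschitz, and so is their composite with a Lipschitz map; exhibiting a
  factorization therefore suffices for membership.
\<close>

lemma OpL_I:
  assumes "space_ideal A" "pointed_metric_space X" "banach_space F" "M \<in> A"
    and "S \<in> Lip X (pointed M)" "B \<in> bounded_operators M F"
    and "T = (\<lambda>x\<in>mspace (fst X). B (S x))"
  shows "T \<in> OpL A X F"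
proof -
  have "banach_space M"
    using assms(1,4) unfolding space_ideal_def by blast
  then have "B \<in> Lip (pointed M) (pointed F)"
    using bounded_operators_subset_Lip assms(3,6) by (blast dest: banach_space.axioms(1))
  then have "T \<in> Lip X (pointed F)"
    using Lip_compose assms(2,5,7) by blast
  then show ?thesis
    using assms unfolding OpL_def factorable_def by blast
qed

lemma OpL_E:
  assumes "space_ideal A" "T \<in> OpL A X F"
  obtains M S B where "M \<in> A" "banach_space M" "S \<in> Lip X (pointed M)"
    "B \<in> bounded_operators M F" "T = (\<lambda>x\<in>mspace (fst X). B (S x))"
  using assms unfolding OpL_def factorable_def space_ideal_def by blast

lemma OpL_elementary:
  assumes A: "space_ideal A" and X: "pointed_metric_space X" and F: "banach_space F"
    and g: "g \<in> Lip_dual X" and e: "e \<in> carrier F"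
  shows "(\<lambda>x\<in>mspace (fst X). g x \<odot>\<^bsub>F\<^esub> e) \<in> OpL A X F"
proof -
  interpret F: banach_space F by fact
  interpret L: banach_space "line F e" by (rule F.banach_space_line[OF e])
  have "line F e \<in> A"
    using A F.banach_space_line[OF e] F.finite_dimensional_line[OF e]
    unfolding space_ideal_def by blast
  moreover have "(\<lambda>c. c \<odot>\<^bsub>F\<^esub> e) \<in> Lip (euclidean_metric, 0) (pointed (line F e))"
    using F.Lipschitz_continuous_map_scale[OF e] F.scale_0[OF e]
    by (simp add: Lip_def pointed_def line_def)
  then have "(\<lambda>x\<in>mspace (fst X). g x \<odot>\<^bsub>F\<^esub> e) \<in> Lip X (pointed (line F e))"
    using Lip_compose g X unfolding Lip_dual_def by blast
  ultimately show ?thesis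
    by (rule OpL_I[OF A X F _ _ F.line_inclusion[OF e]]) (auto simp: F.carrier_line)
qed

lemma OpL_add:
  fixes A :: "('k::{real_normed_field, banach}, 'u) nspace set"
  assumes A: "space_ideal A" and X: "pointed_metric_space X" and F: "banach_space F"
    and T1: "T1 \<in> OpL A X F" and T2: "T2 \<in> OpL A X F"
  shows "(\<lambda>x\<in>mspace (fst X). T1 x \<oplus>\<^bsub>F\<^esub> T2 x) \<in> OpL A X F"
proof -
  obtain M1 S1 B1 where 1: "M1 \<in> A" "banach_space M1" "S1 \<in> Lip X (pointed M1)"
    "B1 \<in> bounded_operators M1 F" "T1 = (\<lambda>x\<in>mspace (fst X). B1 (S1 x))"
    using OpL_E[OF A T1] by blast
  obtain M2 S2 B2 where 2: "M2 \<in> A" "banach_space M2" "S2 \<in> Lip X (pointed M2)"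
    "B2 \<in> bounded_operators M2 F" "T2 = (\<lambda>x\<in>mspace (fst X). B2 (S2 x))"
    using OpL_E[OF A T2] by blast
  let ?P = "prod_nspace M1 M2"
  have P: "banach_space ?P"
    by (intro banach_space_prod_nspace 1 2)
  note norm = banach_space.axioms(1)[OF F] banach_space.axioms(1)[OF 1(2)]
    banach_space.axioms(1)[OF 2(2)] banach_space.axioms(1)[OF P]
  obtain \<phi> :: "'u \<times> 'u \<Rightarrow> 'u" where \<phi>: "inj_on \<phi> (carrier ?P)"
    using ex_inj_on_prod_carriers[OF norm(2,3)] by auto
  define M where "M = transport_nspace \<phi> ?P"
  have iso: "isomorphic M ?P" and M_norm: "normed_space M"
    unfolding M_def by (intro isomorphic_transport_nspace normed_space_transport_nspace norm \<phi>)+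
  have "banach_space M"
    by (rule banach_space_isomorphic[OF P M_norm iso])
  then have "M \<in> A"
    using A 1(1) 2(1) iso unfolding space_ideal_def by blast
  \<comment> \<open>The factorization through the product is routed through the copy \<open>M\<close> of the product:
    \<open>X \<rightarrow> M1 \<times> M2 \<rightarrow> M \<rightarrow> M1 \<times> M2 \<rightarrow> F\<close>, where the middle arrows \<open>V\<close> and \<open>U\<close> cancel.\<close>
  obtain U V where U: "U \<in> bounded_operators M ?P" and V: "V \<in> bounded_operators ?P M"
    and UV: "\<And>z. z \<in> carrier ?P \<Longrightarrow> U (V z) = z"
    using iso unfolding isomorphic_def by blast
  define S where "S = (\<lambda>x\<in>mspace (fst X). V ((\<lambda>x\<in>mspace (fst X). (S1 x, S2 x)) x))"
  have S: "S \<in> Lip X (pointed M)"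
    unfolding S_def using V bounded_operators_subset_Lip[OF norm(4) M_norm]
    by (intro Lip_compose[OF Lip_pair[OF norm(2,3) 1(3) 2(3) X] _ X]) blast
  note proj = prod_nspace_projections[OF norm(2,3)]
  define Q where "Q = (\<lambda>z\<in>carrier ?P.
      (\<lambda>z\<in>carrier ?P. B1 ((\<lambda>z\<in>carrier ?P. fst z) z)) z \<oplus>\<^bsub>F\<^esub>
      (\<lambda>z\<in>carrier ?P. B2 ((\<lambda>z\<in>carrier ?P. snd z) z)) z)"
  have Q: "Q \<in> bounded_operators ?P F"
    unfolding Q_def
    by (intro bounded_operators_add bounded_operators_compose[OF _ _ proj(1) 1(4)]
        bounded_operators_compose[OF _ _ proj(2) 2(4)] norm)
  have QU: "(\<lambda>z\<in>carrier M. Q (U z)) \<in> bounded_operators M F"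
    by (rule bounded_operators_compose[OF M_norm norm(4) U Q])
  show ?thesis
  proof (rule OpL_I[OF A X F \<open>M \<in> A\<close> S QU], rule restrict_ext)
    fix x
    assume x: "x \<in> mspace (fst X)"
    have S12: "(S1 x, S2 x) \<in> carrier ?P"
      using Lip_pointed_closed[OF norm(2) 1(3) x] Lip_pointed_closed[OF norm(3) 2(3) x] by simp
    then show "T1 x \<oplus>\<^bsub>F\<^esub> T2 x = (\<lambda>z\<in>carrier M. Q (U z)) (S x)"
      using x UV[OF S12] bounded_operatorsD(2)[OF V S12] by (simp add: S_def Q_def 1(5) 2(5))
  qed
qed

lemma OpL_compose:
  assumes A: "space_ideal A" and X0: "pointed_metric_space X0"
    and F: "banach_space F" and F0: "banach_space F0"
    and S: "S \<in> Lip X0 X" and T: "T \<in> OpL A X F" and R: "R \<in> bounded_operators F F0"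
  shows "(\<lambda>x\<in>mspace (fst X0). R (T (S x))) \<in> OpL A X0 F0"
proof -
  obtain M S1 B where M: "M \<in> A" "banach_space M" "S1 \<in> Lip X (pointed M)"
    "B \<in> bounded_operators M F" "T = (\<lambda>x\<in>mspace (fst X). B (S1 x))"
    using OpL_E[OF A T] by blast
  have RB: "(\<lambda>z\<in>carrier M. R (B z)) \<in> bounded_operators M F0"
    by (intro bounded_operators_compose[OF _ _ M(4) R] banach_space.axioms F M)
  show ?thesis
  proof (rule OpL_I[OF A X0 F0 M(1) Lip_compose[OF S M(3) X0] RB], rule restrict_ext)
    fix x
    assume x: "x \<in> mspace (fst X0)"
    then have Sx: "S x \<in> mspace (fst X)"
      using S Lipschitz_continuous_map_image unfolding Lip_def by blast
    then have "S1 (S x) \<in> carrier M"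
      by (rule Lip_pointed_closed[OF banach_space.axioms(1)[OF M(2)] M(3)])
    then show "R (T (S x)) = (\<lambda>z\<in>carrier M. R (B z)) ((\<lambda>x\<in>mspace (fst X0). S1 (S x)) x)"
      using x Sx by (simp add: M(5))
  qed
qed

theorem proposition3:
  fixes A :: "('k::{real_normed_field, banach}, 'u) nspace set"
  assumes "space_ideal A"
  shows "nonlinear_ideal (OpL A :: ('k, 'm, 'u) op_class)"
  unfolding nonlinear_ideal_def
proof (intro allI impI conjI ballI, goal_cases)
  case (1 X F)
  show ?case
    unfolding OpL_def by blast
next
  case (2 X F g e)
  then show ?case
    using OpL_elementary[OF assms] by blast
next
  case (3 X F S T)
  then show ?case
    using OpL_add[OF assms] by blast
next
  case (4 X F X0 F0 S T R)
  then show ?case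
    using OpL_compose[OF assms] by blast
qed

end
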